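(* Let $M,K,H,I,J$ be positive integers and let $\mathbb{X}\subseteq\mathbb{R}^K$ be closed. Suppose the uncertainty set is the polytope $\Xi=\{\bm{\xi}\in\mathbb{R}^M:\bm{C}\bm{\xi}\le\bm{g}\}$, where $\bm{C}$ is a matrix and $\bm{g}$ a vector of appropriate dimension. Suppose that for every fixed $\bm{x}\in\mathbb{X}$ the objective function is $\ell(\bm{x},\bm{\xi})=\max_{j\in[J]}\{\langle\bm{a}_j,\bm{\xi}\rangle+b_j\}$, where $\bm{a}_j=\bm{a}_j(\bm{x})\in\mathbb{R}^M$ and $b_j=b_j(\bm{x})\in\mathbb{R}$ are linear in $\bm{x}$ for all $j\in[J]$. Let $\hat{\bm{\xi}}^{(i)}_h\in\Xi$ ($h\in[H]$, $i\in[I]$) be given points, let $t^{(I)}_h\in[0,1]$ ($h\in[H]$) be weights with $\sum_{h=1}^H t^{(I)}_h=1$, and let $\hat{\mathbb{P}}_{HI}:=\sum_{h=1}^{H}\frac{t^{(I)}_h}{I}\sum_{i=1}^{I}\delta_{\hat{\bm{\xi}}^{(i)}_h}$. Then for any $\epsilon\ge0$, the problem $$\inf_{\bm{x}\in\mathbb{X}}\ \sup_{\mathbb{Q}\in\mathbb{B}_\epsilon(\hat{\mathbb{P}}_{HI})}\mathbb{E}^{\mathbb{Q}}[\ell(\bm{x},\bm{\xi})]$$ is equivalent to $$\begin{aligned} \inf_{\bm{x},\,\lambda,\,s_{hi},\,\bm{\gamma}_{hij}}\quad & \lambda\epsilon+\sum_{h=1}^{H}\sum_{i=1}^{I}\frac{t^{(I)}_h}{I}\,s_{hi}\\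 \text{s.t.}\quad & \bm{x}\in\mathbb{X},\\ & b_j+\langle\bm{a}_j,\hat{\bm{\xi}}^{(i)}_h\rangle+\langle\bm{\gamma}_{hij},\bm{g}-\bm{C}\hat{\bm{\xi}}^{(i)}_h\rangle\le s_{hi},\quad\forall h\in[H],\,i\in[I],\,j\in[J],\\ & \|\bm{C}^{\mathsf T}\bm{\gamma}_{hij}-\bm{a}_j\|_*\le\lambda,\quad\forall h\in[H],\,i\in[I],\,j\in[J],\\ & \bm{\gamma}_{hij}\ge0,\quad\forall h\in[H],\,i\in[I],\,j\in[J], \end{aligned}$$ in the sense that for each fixed $\bm{x}\in\mathbb{X}$ the inner supremum equals the infimum of the second program over the remaining variables $(\lambda,s_{hi},\bm{\gamma}_{hij})$; in particular the two problems have the same optimal value.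
   Context: Notation: $[N]=\{1,\dots,N\}$; $\langle\bm{u},\bm{v}\rangle=\bm{u}^{\mathsf T}\bm{v}$; $\delta_{\bm{\xi}_0}$ is the Dirac point mass at $\bm{\xi}_0$; vector inequalities are componentwise. $\|\cdot\|$ is an arbitrary fixed norm on $\mathbb{R}^M$ and $\|\bm{v}\|_*:=\sup_{\|\bm{u}\|\le1}\langle\bm{v},\bm{u}\rangle$ is its dual norm. $\mathcal{M}(\Xi)$ is the set of all probability distributions $\mathbb{Q}$ on $\Xi$ with $\mathbb{E}^{\mathbb{Q}}[\|\bm{\xi}\|]<\infty$. The Wasserstein distance is $d_W(\hat{\mathbb{P}},\mathbb{Q})=\inf_{\Pi}\int_{\Xi^2}\|\bm{\xi}-\bm{\xi}'\|\,\Pi(d\bm{\xi},d\bm{\xi}')$, the infimum being over joint distributions $\Pi$ of $\bm{\xi}$ and $\bm{\xi}'$ with marginals $\mathbb{Q}$ and $\hat{\mathbb{P}}$ respectively. The ambiguity set is $\mathbb{B}_\epsilon(\hat{\mathbb{P}}_{HI})=\{\mathbb{Q}\in\mathcal{M}(\Xi): d_W(\hat{\mathbb{P}}_{HI},\mathbb{Q})\le\epsilon\}$. *)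

theory Defs
  imports "HOL-Probability.Probability"
begin

text \<open>An arbitrary norm on \<open>\<real>\<^sup>M\<close> cannot be the type-class norm, which on
  \<^typ>\<open>real ^ 'm\<close> is the Euclidean one.\<close>

definition is_norm :: "('a::real_vector \<Rightarrow> real) \<Rightarrow> bool" where
  "is_norm N \<longleftrightarrow>
     (\<forall>x. 0 \<le> N x) \<and> (\<forall>x. N x = 0 \<longleftrightarrow> x = 0) \<and>
     (\<forall>c x. N (c *\<^sub>R x) = \<bar>c\<bar> * N x) \<and> (\<forall>x y. N (x + y) \<le> N x + N y)"

definition dual_norm :: "('a::real_inner \<Rightarrow> real) \<Rightarrow> 'a \<Rightarrow> real" where
  "dual_norm N v = (SUP u\<in>{u. N u \<le> 1}. v \<bullet> u)"

abbreviation borel_on :: "'a::topological_space set \<Rightarrow> 'a measure" where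
  "borel_on Xi \<equiv> restrict_space borel Xi"

definition finite_mean_distributions ::
    "('a::real_normed_vector \<Rightarrow> real) \<Rightarrow> 'a set \<Rightarrow> 'a measure set" where
  "finite_mean_distributions N Xi =
     {Q. prob_space Q \<and> sets Q = sets (borel_on Xi) \<and> (\<integral>\<^sup>+ \<xi>. ennreal (N \<xi>) \<partial>Q) < \<infinity>}"

definition couplings ::
    "'a::topological_space set \<Rightarrow> 'a measure \<Rightarrow> 'a measure \<Rightarrow> ('a \<times> 'a) measure set" where
  "couplings Xi Q P =
     {\<kappa>. prob_space \<kappa> \<and> sets \<kappa> = sets (borel_on Xi \<Otimes>\<^sub>M borel_on Xi) \<and>
         distr \<kappa> (borel_on Xi) fst = Q \<and> distr \<kappa> (borel_on Xi) snd = P}"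

definition wasserstein ::
    "('a::real_normed_vector \<Rightarrow> real) \<Rightarrow> 'a set \<Rightarrow> 'a measure \<Rightarrow> 'a measure \<Rightarrow> ennreal" where
  "wasserstein N Xi P Q = (INF \<kappa>\<in>couplings Xi Q P. \<integral>\<^sup>+ (\<xi>, \<xi>'). ennreal (N (\<xi> - \<xi>')) \<partial>\<kappa>)"

definition wasserstein_ball ::
    "('a::real_normed_vector \<Rightarrow> real) \<Rightarrow> 'a set \<Rightarrow> real \<Rightarrow> 'a measure \<Rightarrow> 'a measure set" where
  "wasserstein_ball N Xi \<epsilon> P =
     {Q \<in> finite_mean_distributions N Xi. wasserstein N Xi P Q \<le> ennreal \<epsilon>}"

definition weighted_empirical ::
    "'a::topological_space set \<Rightarrow> nat \<Rightarrow> nat \<Rightarrow> (nat \<Rightarrow> real) \<Rightarrow> (nat \<Rightarrow> nat \<Rightarrow> 'a) \<Rightarrow> 'a measure" where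
  "weighted_empirical Xi H I t xi =
     measure_of Xi (sets (borel_on Xi))
       (\<lambda>A. \<Sum>h=1..H. ennreal (t h / real I) *
          (\<Sum>i=1..I. emeasure (return (borel_on Xi) (xi h i)) A))"

text \<open>\<^const>\<open>measure_of\<close> silently yields the zero measure if its argument is not countably
  additive; the next two facts confirm that this does not happen here.\<close>

lemma sets_weighted_empirical [simp]:
  "sets (weighted_empirical Xi H I t xi) = sets (borel_on Xi)"
  unfolding weighted_empirical_def
  by (metis (no_types) sets.sigma_sets_eq sets_measure_of sets.space_closed space_restrict_space
      space_borel Int_UNIV_right)

lemma emeasure_weighted_empirical:
  assumes "A \<in> sets (borel_on Xi)"
  shows "emeasure (weighted_empirical Xi H I t xi) A =
    (\<Sum>h=1..H. ennreal (t h / real I) *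
       (\<Sum>i=1..I. emeasure (return (borel_on Xi) (xi h i)) A))"
proof -
  define \<mu> where "\<mu> A = (\<Sum>h=1..H. ennreal (t h / real I) *
       (\<Sum>i=1..I. emeasure (return (borel_on Xi) (xi h i)) A))" for A
  have sp: "space (borel_on Xi) = Xi" by (simp add: space_restrict_space)
  have "emeasure (measure_of Xi (sets (borel_on Xi)) \<mu>) A = \<mu> A"
  proof (rule emeasure_measure_of[OF refl])
    show "sets (borel_on Xi) \<subseteq> Pow Xi" using sets.space_closed[of "borel_on Xi"] sp by simp
    have ms: "sets (measure_of Xi (sets (borel_on Xi)) \<mu>) = sets (borel_on Xi)"
      by (metis sets.sigma_sets_eq sets_measure_of sets.space_closed sp)
    show "A \<in> sets (measure_of Xi (sets (borel_on Xi)) \<mu>)" using ms assms by simp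
    show "positive (sets (measure_of Xi (sets (borel_on Xi)) \<mu>)) \<mu>"
      by (simp add: positive_def \<mu>_def)
    show "countably_additive (sets (measure_of Xi (sets (borel_on Xi)) \<mu>)) \<mu>"
      unfolding ms countably_additive_def
    proof (intro allI impI)
      fix F :: "nat \<Rightarrow> 'a set"
      assume F: "range F \<subseteq> sets (borel_on Xi)" "disjoint_family F"
      have "(\<Sum>n. \<mu> (F n)) = (\<Sum>h=1..H. \<Sum>n. ennreal (t h / real I) *
          (\<Sum>i=1..I. emeasure (return (borel_on Xi) (xi h i)) (F n)))"
        unfolding \<mu>_def by (intro suminf_sum summableI)
      also have "\<dots> = (\<Sum>h=1..H. ennreal (t h / real I) *
          (\<Sum>i=1..I. \<Sum>n. emeasure (return (borel_on Xi) (xi h i)) (F n)))"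
        by (simp add: suminf_sum summableI)
      also have "\<dots> = \<mu> (\<Union>n. F n)"
        unfolding \<mu>_def using F by (simp add: suminf_emeasure del: emeasure_return)
      finally show "(\<Sum>n. \<mu> (F n)) = \<mu> (\<Union>n. F n)" .
    qed
  qed
  then show ?thesis unfolding weighted_empirical_def \<mu>_def[abs_def] .
qed

definition worst_case_expectation ::
    "('a::real_normed_vector \<Rightarrow> real) \<Rightarrow> 'a set \<Rightarrow> real \<Rightarrow> 'a measure \<Rightarrow> ('a \<Rightarrow> real) \<Rightarrow> ereal" where
  "worst_case_expectation N Xi \<epsilon> P f =
     (SUP Q\<in>wasserstein_ball N Xi \<epsilon> P. ereal (\<integral>\<xi>. f \<xi> \<partial>Q))"

definition dual_feasible ::
    "(real ^ 'm \<Rightarrow> real) \<Rightarrow> real ^ 'm ^ 'p \<Rightarrow> real ^ 'p \<Rightarrow> nat \<Rightarrow> nat \<Rightarrow> nat \<Rightarrow>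
     (nat \<Rightarrow> nat \<Rightarrow> real ^ 'm) \<Rightarrow> (nat \<Rightarrow> real ^ 'm) \<Rightarrow> (nat \<Rightarrow> real) \<Rightarrow>
     (real \<times> (nat \<Rightarrow> nat \<Rightarrow> real) \<times> (nat \<Rightarrow> nat \<Rightarrow> nat \<Rightarrow> real ^ 'p)) set" where
  "dual_feasible N C g H I J xi a b =
     {(lam, s, \<gamma>). \<forall>h\<in>{1..H}. \<forall>i\<in>{1..I}. \<forall>j\<in>{1..J}.
        b j + a j \<bullet> xi h i + \<gamma> h i j \<bullet> (g - C *v xi h i) \<le> s h i \<and>
        dual_norm N (transpose C *v \<gamma> h i j - a j) \<le> lam \<and>
        0 \<le> \<gamma> h i j}"

definition dual_objective ::
    "real \<Rightarrow> nat \<Rightarrow> nat \<Rightarrow> (nat \<Rightarrow> real) \<Rightarrow> real \<Rightarrow> (nat \<Rightarrow> nat \<Rightarrow> real) \<Rightarrow> real" where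
  "dual_objective \<epsilon> H I t lam s = lam * \<epsilon> + (\<Sum>h=1..H. \<Sum>i=1..I. t h / real I * s h i)"

end

theory Submission
  imports Defs
begin

text \<open>
  Fix \<open>x\<close> and let \<open>f\<close> be the piecewise affine loss. Two dualities are composed.

  The first holds for every Lipschitz \<open>f\<close> (\<open>worst_case_expectation_dual\<close>): the worst-case expectation
  is the infimum of \<open>lam * \<epsilon>\<close> plus the weighted sum of the numbers \<open>s k\<close>, subject to
  \<open>f \<xi> \<le> s k + lam * N (\<xi> - y k)\<close> for all \<open>\<xi>\<close> in \<open>Xi\<close> and all atoms \<open>y k\<close>. Integrating this constraint
  against a nearly optimal coupling shows that no member of the ball exceeds the dual value
  (\<open>wasserstein_ball_integral_le\<close>). For the converse, consider plans that move each atom to one point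
  of \<open>Xi\<close>. Mixtures of two plans within the budget \<open>\<epsilon>\<close> are members of the ball, which suffices for a
  supporting line at \<open>\<epsilon>\<close> to the gain as a function of the transport cost
  (\<open>supergradient_of_mixtures\<close>). Its slope is \<open>lam\<close>. Once transport is priced, the atoms decouple, and
  \<open>s k\<close> is the supremum of \<open>f \<xi> - lam * N (\<xi> - y k)\<close>. No worst-case distribution need exist: when
  \<open>Xi\<close> is unbounded, mass may have to escape to infinity. The argument only uses the values of
  actual plans. The Lipschitz bound makes the dual feasible and provides the slope when \<open>\<epsilon> = 0\<close>.

  The second duality treats one affine piece \<open>a \<bullet> \<xi> + b\<close> and one atom \<open>\<xi>'\<close>: the piece stays below
  \<open>s + lam * N (\<xi> - \<xi>')\<close> on the polyhedron exactly if a multiplier \<open>\<gamma>\<close> as in the finite program exists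
  (\<open>dual_feasible_imp_bound\<close>, \<open>bound_imp_multiplier\<close>). A linear functional is inserted between the
  norm and the affine function by separating two convex sets, and its difference from \<open>a\<close> is then
  handled by the affine form of Farkas' lemma.
\<close>

section \<open>Arbitrary norms on a Euclidean space\<close>

lemma is_norm_nonneg: "is_norm N \<Longrightarrow> 0 \<le> N x"
  and is_norm_zero: "is_norm N \<Longrightarrow> N 0 = 0"
  and is_norm_eq_0D: "is_norm N \<Longrightarrow> N x = 0 \<Longrightarrow> x = 0"
  and is_norm_scaleR: "is_norm N \<Longrightarrow> N (c *\<^sub>R x) = \<bar>c\<bar> * N x"
  and is_norm_triangle: "is_norm N \<Longrightarrow> N (x + y) \<le> N x + N y"
  unfolding is_norm_def by blast+

lemma is_norm_minus: "is_norm N \<Longrightarrow> N (- x) = N x"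
  using is_norm_scaleR[of N "-1" x] by simp

lemma is_norm_convex:
  fixes N :: "'a::real_vector \<Rightarrow> real"
  assumes "is_norm N"
  shows "convex_on UNIV N"
proof (rule convex_onI)
  fix u :: real and x y :: 'a
  assume "0 < u" "u < 1"
  then show "N ((1 - u) *\<^sub>R x + u *\<^sub>R y) \<le> (1 - u) * N x + u * N y"
    using is_norm_triangle[OF assms, of "(1 - u) *\<^sub>R x" "u *\<^sub>R y"]
    by (simp add: is_norm_scaleR[OF assms])
qed simp

lemma is_norm_continuous:
  fixes N :: "'a::euclidean_space \<Rightarrow> real"
  assumes "is_norm N"
  shows "continuous_on UNIV N"
  using convex_on_continuous[OF open_UNIV is_norm_convex[OF assms]] .

lemma is_norm_borel_measurable:
  fixes N :: "'a::euclidean_space \<Rightarrow> real"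
  assumes "is_norm N"
  shows "N \<in> borel_measurable borel"
  using borel_measurable_continuous_onI[OF is_norm_continuous[OF assms]] .

text \<open>All norms on a Euclidean space are equivalent, so \<open>N\<close> dominates a multiple of the Euclidean
norm (its minimum over the unit sphere) and every linear functional is Lipschitz for \<open>N\<close>.\<close>

lemma inner_le_is_norm:
  fixes N :: "'a::euclidean_space \<Rightarrow> real"
  assumes "is_norm N"
  obtains L where "0 \<le> L" "\<And>z. v \<bullet> z \<le> L * N z"
proof -
  have "\<exists>m>0. \<forall>z. m * norm z \<le> N z"
  proof -
    have ne: "sphere 0 1 \<noteq> ({} :: 'a set)"
      by (metis ex_in_conv mem_sphere_0 nonempty_Basis norm_Basis)
    obtain u where u: "norm u = 1" "\<And>x. norm x = 1 \<Longrightarrow> N u \<le> N x"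
      using continuous_attains_inf[OF compact_sphere ne
          continuous_on_subset[OF is_norm_continuous[OF assms]]]
      by (metis mem_sphere_0 subset_UNIV)
    have "N u > 0"
      using is_norm_nonneg[OF assms, of u] is_norm_eq_0D[OF assms, of u] u(1) by force
    moreover have "N u * norm z \<le> N z" for z
    proof (cases "z = 0")
      case True
      then show ?thesis by (simp add: is_norm_zero[OF assms])
    next
      case False
      then have "N u \<le> N ((1 / norm z) *\<^sub>R z)" by (intro u(2)) simp
      then show ?thesis using False by (simp add: is_norm_scaleR[OF assms] field_simps)
    qed
    ultimately show ?thesis by blast
  qed
  then obtain m where m: "m > 0" "\<And>z. m * norm z \<le> N z" by blast
  have "v \<bullet> z \<le> norm v / m * N z" for z
  proof -
    have "v \<bullet> z \<le> norm v * norm z" by (rule norm_cauchy_schwarz)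
    also have "\<dots> \<le> norm v * (N z / m)"
      using m(2)[of z] m(1) by (intro mult_left_mono) (auto simp: field_simps)
    finally show ?thesis by simp
  qed
  then show ?thesis using that[of "norm v / m"] m(1) by simp
qed

text \<open>Since \<^const>\<open>dual_norm\<close> is a real supremum, it only carries information once the supremum is
known to be over a bounded set; afterwards it can be replaced by the homogeneous inequality that
all later arguments use.\<close>

lemma dual_norm_le_iff:
  fixes N :: "'a::euclidean_space \<Rightarrow> real"
  assumes N: "is_norm N"
  shows "dual_norm N v \<le> lam \<longleftrightarrow> 0 \<le> lam \<and> (\<forall>z. v \<bullet> z \<le> lam * N z)"
proof
  assume le: "dual_norm N v \<le> lam"
  obtain L where L: "0 \<le> L" "\<And>z. v \<bullet> z \<le> L * N z" using inner_le_is_norm[OF N, of v] by metis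
  have bdd: "bdd_above ((\<bullet>) v ` {u. N u \<le> 1})"
  proof (rule bdd_aboveI2)
    fix u assume "u \<in> {u. N u \<le> 1}"
    then show "v \<bullet> u \<le> L"
      using L(2)[of u] mult_left_mono[of "N u" 1 L] L(1) by simp
  qed
  have unit: "v \<bullet> u \<le> lam" if "N u \<le> 1" for u
    using cSUP_upper[OF _ bdd, of u] that le unfolding dual_norm_def by simp
  have "v \<bullet> z \<le> lam * N z" for z
  proof (cases "z = 0")
    case False
    then have pos: "N z > 0"
      using is_norm_nonneg[OF N, of z] is_norm_eq_0D[OF N, of z] by force
    then show ?thesis
      using unit[of "(1 / N z) *\<^sub>R z"] by (simp add: is_norm_scaleR[OF N] field_simps)
  qed (simp add: is_norm_zero[OF N])
  moreover have "0 \<le> lam" using unit[of 0] by (simp add: is_norm_zero[OF N])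
  ultimately show "0 \<le> lam \<and> (\<forall>z. v \<bullet> z \<le> lam * N z)" by blast
next
  assume r: "0 \<le> lam \<and> (\<forall>z. v \<bullet> z \<le> lam * N z)"
  show "dual_norm N v \<le> lam"
    unfolding dual_norm_def
  proof (rule cSUP_least)
    show "{u. N u \<le> 1} \<noteq> {}" using is_norm_zero[OF N] by (auto intro!: exI[of _ 0])
    fix u assume "u \<in> {u. N u \<le> 1}"
    then show "v \<bullet> u \<le> lam"
      using r mult_left_mono[of "N u" 1 lam] by (force intro: order_trans)
  qed
qed

section \<open>Multipliers for a maximum over a polyhedron\<close>

text \<open>The pairs \<open>(w, \<rho>)\<close> for which \<open>w \<bullet> z \<le> \<rho>\<close> follows from \<open>C *v z \<le> d\<close> by a nonnegative combination of
the rows form a cone with finitely many generators: the rows of \<open>(C, d)\<close> and \<open>(0, 1)\<close>. Such a cone is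
closed, so if \<open>(v, r)\<close> lay outside, a separating functional \<open>(- z, \<tau>)\<close> with \<open>\<tau> \<ge> 0\<close> would exist.
If \<open>\<tau> > 0\<close>, the point \<open>z / \<tau>\<close> violates the implication. If \<open>\<tau> = 0\<close>, then \<open>z\<close> is a recession
direction along which \<open>v\<close> grows; as \<open>0\<close> satisfies the constraints because \<open>d \<ge> 0\<close>, a large
multiple of \<open>z\<close> violates it.\<close>

lemma affine_farkas:
  fixes C :: "real ^ 'm ^ 'p"
  assumes d: "0 \<le> d" and imp: "\<And>z. C *v z \<le> d \<Longrightarrow> v \<bullet> z \<le> r"
  obtains \<gamma> where "0 \<le> \<gamma>" "transpose C *v \<gamma> = v" "\<gamma> \<bullet> d \<le> r"
proof -
  define S where "S = insert (0, 1) (range (\<lambda>i. (row i C, d $ i)))"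
  define K where "K = {(w, \<rho>). \<exists>\<gamma>\<ge>0. transpose C *v \<gamma> = w \<and> \<gamma> \<bullet> d \<le> \<rho>}"
  have "convex_cone K"
    unfolding convex_cone_iff
  proof (intro conjI ballI allI impI)
    show "0 \<in> K" by (auto simp: K_def zero_prod_def intro!: exI[of _ 0])
  next
    fix x y assume "x \<in> K" "y \<in> K"
    then obtain \<gamma> \<gamma>' where "0 \<le> \<gamma>" "0 \<le> \<gamma>'" "transpose C *v \<gamma> = fst x" "transpose C *v \<gamma>' = fst y"
      "\<gamma> \<bullet> d \<le> snd x" "\<gamma>' \<bullet> d \<le> snd y"
      by (auto simp: K_def)
    then show "x + y \<in> K"
      by (auto simp: K_def split_beta matrix_vector_right_distrib inner_add_left
          simp del: transpose_matrix_vector intro!: exI[of _ "\<gamma> + \<gamma>'"])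
  next
    fix x and c :: real assume "x \<in> K" "0 \<le> c"
    then obtain \<gamma> where "0 \<le> \<gamma>" "transpose C *v \<gamma> = fst x" "\<gamma> \<bullet> d \<le> snd x"
      by (auto simp: K_def)
    then show "c *\<^sub>R x \<in> K" using \<open>0 \<le> c\<close>
      by (auto simp: K_def split_beta matrix_vector_mult_scaleR less_eq_vec_def mult_left_mono
          simp del: transpose_matrix_vector intro!: exI[of _ "c *\<^sub>R \<gamma>"])
  qed
  moreover have "S \<subseteq> K"
  proof -
    have "(row i C, d $ i) \<in> K" for i
    proof -
      have "0 \<le> axis i (1 :: real)" by (simp add: less_eq_vec_def axis_def)
      moreover have "transpose C *v axis i 1 = row i C"
        by (simp only: matrix_vector_mult_basis column_transpose)
      moreover have "axis i 1 \<bullet> d = d $ i" by (simp add: inner_axis')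
      ultimately have "\<exists>\<gamma>\<ge>0. transpose C *v \<gamma> = row i C \<and> \<gamma> \<bullet> d \<le> d $ i"
        by (metis order_refl)
      then show ?thesis by (simp add: K_def del: transpose_matrix_vector)
    qed
    moreover have "(0, 1) \<in> K" by (auto simp: K_def intro!: exI[of _ 0])
    ultimately show ?thesis by (auto simp: S_def)
  qed
  ultimately have hull: "convex_cone hull S \<subseteq> K" by (intro hull_minimal)
  have "(v, r) \<in> convex_cone hull S"
  proof (rule ccontr)
    assume "(v, r) \<notin> convex_cone hull S"
    moreover have "closed (convex_cone hull S)"
      by (rule closed_convex_cone_hull) (simp add: S_def)
    ultimately obtain p \<beta> where p: "p \<bullet> (v, r) < \<beta>" "\<And>x. x \<in> convex_cone hull S \<Longrightarrow> p \<bullet> x > \<beta>"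
      using separating_hyperplane_closed_point[OF convex_convex_cone_hull] by metis
    \<comment> \<open>The sign makes \<open>z\<close> a candidate for a point violating the implication.\<close>
    obtain z \<tau> where zt: "p = (- z, \<tau>)" by (metis minus_minus surj_pair)
    have \<beta>: "\<beta> < 0" using p(2)[OF convex_cone_hull_contains_0] by simp
    have nonneg: "0 \<le> p \<bullet> x" if x: "x \<in> convex_cone hull S" for x
    proof (rule ccontr)
      assume neg: "\<not> 0 \<le> p \<bullet> x"
      then have "(\<beta> / (p \<bullet> x)) *\<^sub>R x \<in> convex_cone hull S"
        using \<beta> x by (intro convex_cone_hull_mul) (auto simp: divide_nonpos_nonpos)
      from p(2)[OF this] show False using neg by simp
    qed
    have \<tau>: "0 \<le> \<tau>" using nonneg[OF hull_inc, of "(0, 1)"] by (simp add: S_def zt)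
    have rows: "row i C \<bullet> z \<le> \<tau> * d $ i" for i
      using nonneg[OF hull_inc, of "(row i C, d $ i)"] by (simp add: S_def zt inner_commute)
    have vr: "\<tau> * r < v \<bullet> z" using p(1) \<beta> by (simp add: zt inner_commute mult.commute)
    have Cz: "(C *v z) $ i = row i C \<bullet> z" for i
      by (simp add: matrix_mult_dot row_def vec_lambda_eta)
    show False
    proof (cases "\<tau> = 0")
      case True
      define k where "k = (\<bar>r\<bar> + 1) / (v \<bullet> z)"
      have k: "0 \<le> k" "k * (v \<bullet> z) = \<bar>r\<bar> + 1" using vr True by (auto simp: k_def field_simps)
      have "k * (row i C \<bullet> z) \<le> 0" for i
        using rows[of i] True k(1) by (simp add: mult_nonneg_nonpos)
      then have "C *v (k *\<^sub>R z) \<le> d"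
        using d by (auto simp: less_eq_vec_def matrix_vector_mult_scaleR Cz
            intro: order_trans[of _ 0])
      from imp[OF this] show False using k(2) by simp
    next
      case False
      then have \<tau>: "0 < \<tau>" using \<tau> by simp
      have "C *v ((1 / \<tau>) *\<^sub>R z) \<le> d"
        using rows \<tau> by (auto simp: less_eq_vec_def matrix_vector_mult_scaleR Cz field_simps)
      from imp[OF this] show False using vr \<tau> by (simp add: field_simps)
    qed
  qed
  then have "(v, r) \<in> K" using hull by blast
  then show ?thesis using that by (auto simp: K_def)
qed

text \<open>A Fenchel sandwich: the convex function \<open>lam * N\<close> lies above the concave function that is
\<open>a \<bullet> z - r\<close> on \<open>D\<close>, so a hyperplane separates the strict epigraph of one from the hypograph of the
other. It cannot be vertical because \<open>N\<close> is finite everywhere, so it is the graph of an affine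
function. Homogeneity of \<open>N\<close> then removes its constant term from the bound by \<open>lam * N\<close>.\<close>

lemma linear_between_norm_and_affine:
  fixes N :: "'a::euclidean_space \<Rightarrow> real"
  assumes N: "is_norm N" and lam: "0 \<le> lam" and D: "convex D" "D \<noteq> {}"
    and le: "\<And>z. z \<in> D \<Longrightarrow> a \<bullet> z \<le> r + lam * N z"
  obtains u where "\<And>z. u \<bullet> z \<le> lam * N z" "\<And>z. z \<in> D \<Longrightarrow> (a - u) \<bullet> z \<le> r"
proof -
  define A where "A = {(z, \<tau>). lam * N z < \<tau>}"
  define B where "B = {(z, \<tau>). z \<in> D \<and> \<tau> \<le> a \<bullet> z - r}"
  have "convex A"
  proof (rule convexI)
    fix x y and s t :: real
    assume xy: "x \<in> A" "y \<in> A" and st: "0 \<le> s" "0 \<le> t" "s + t = 1"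
    have "lam * N (s *\<^sub>R fst x + t *\<^sub>R fst y) \<le> lam * (s * N (fst x) + t * N (fst y))"
      using is_norm_triangle[OF N, of "s *\<^sub>R fst x" "t *\<^sub>R fst y"] st
      by (intro mult_left_mono[OF _ lam]) (simp add: is_norm_scaleR[OF N])
    also have "\<dots> = s * (lam * N (fst x)) + t * (lam * N (fst y))" by (simp add: algebra_simps)
    also have "\<dots> < s * snd x + t * snd y"
    proof (cases "s = 0")
      case True
      then show ?thesis using xy st by (auto simp: A_def)
    next
      case False
      then show ?thesis using xy st
        by (intro add_less_le_mono mult_strict_left_mono mult_left_mono) (auto simp: A_def)
    qed
    finally show "s *\<^sub>R x + t *\<^sub>R y \<in> A" by (simp add: A_def split_beta)
  qed
  moreover have "convex B"
  proof (rule convexI)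
    fix x y and s t :: real
    assume xy: "x \<in> B" "y \<in> B" and st: "0 \<le> s" "0 \<le> t" "s + t = 1"
    have "s * snd x + t * snd y \<le> s * (a \<bullet> fst x - r) + t * (a \<bullet> fst y - r)"
      using xy st by (intro add_mono mult_left_mono) (auto simp: B_def)
    also have "\<dots> = a \<bullet> (s *\<^sub>R fst x + t *\<^sub>R fst y) - (s + t) * r"
      by (simp add: algebra_simps inner_simps)
    finally show "s *\<^sub>R x + t *\<^sub>R y \<in> B"
      using convexD[OF D(1), of "fst x" "fst y" s t] xy st by (auto simp: B_def split_beta)
  qed
  moreover have "A \<noteq> {}" by (auto simp: A_def intro: exI[of _ 0] lt_ex gt_ex)
  moreover have "B \<noteq> {}" using D(2) by (auto simp: B_def)
  moreover have "A \<inter> B = {}" using le by (force simp: A_def B_def)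
  ultimately obtain p c where p: "p \<noteq> 0" "\<And>x. x \<in> A \<Longrightarrow> p \<bullet> x \<le> c" "\<And>x. x \<in> B \<Longrightarrow> c \<le> p \<bullet> x"
    using separating_hyperplane_sets[of A B] by metis
  obtain w \<beta> where wb: "p = (w, \<beta>)" by fastforce
  have sepA: "w \<bullet> z + \<beta> * \<tau> \<le> c" if "lam * N z < \<tau>" for z \<tau>
    using p(2)[of "(z, \<tau>)"] that by (simp add: A_def wb)
  have sepB: "c \<le> w \<bullet> z + \<beta> * (a \<bullet> z - r)" if "z \<in> D" for z
    using p(3)[of "(z, a \<bullet> z - r)"] that by (simp add: B_def wb)
  have "\<beta> \<le> 0"
  proof (rule ccontr)
    assume "\<not> \<beta> \<le> 0"
    then show False
      using sepA[of 0 "(\<bar>c\<bar> + 1) / \<beta>"] by (simp add: is_norm_zero[OF N])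
  qed
  moreover have "\<beta> \<noteq> 0"
  proof
    assume b: "\<beta> = 0"
    then have "w \<noteq> 0" using p(1) by (auto simp: wb zero_prod_def)
    then have "w \<bullet> (((\<bar>c\<bar> + 1) / (w \<bullet> w)) *\<^sub>R w) = \<bar>c\<bar> + 1" by simp
    moreover have "w \<bullet> z \<le> c" for z using sepA[of z "lam * N z + 1"] b by simp
    ultimately show False by (smt (verit))
  qed
  ultimately have \<beta>: "\<beta> < 0" by simp
  define u where "u = (1 / - \<beta>) *\<^sub>R w"
  define e where "e = c / - \<beta>"
  have uz: "u \<bullet> z \<le> e + lam * N z" for z
  proof (rule field_le_epsilon)
    fix \<delta> :: real assume "0 < \<delta>"
    then show "u \<bullet> z \<le> e + lam * N z + \<delta>"
      using sepA[of z "lam * N z + \<delta>"] \<beta> by (simp add: u_def e_def field_simps)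
  qed
  have ub: "e \<le> u \<bullet> z - a \<bullet> z + r" if "z \<in> D" for z
    using sepB[OF that] \<beta> by (simp add: u_def e_def field_simps)
  have e: "0 \<le> e" using uz[of 0] by (simp add: is_norm_zero[OF N])
  have "u \<bullet> z \<le> lam * N z" for z
  proof (rule ccontr)
    \<comment> \<open>An excess would grow without bound along the ray through \<open>z\<close>.\<close>
    assume n: "\<not> u \<bullet> z \<le> lam * N z"
    define k where "k = (e + 1) / (u \<bullet> z - lam * N z)"
    have "0 < k" "k * (u \<bullet> z - lam * N z) = e + 1" using n e by (auto simp: k_def)
    then show False using uz[of "k *\<^sub>R z"] by (simp add: is_norm_scaleR[OF N] algebra_simps)
  qed
  moreover have "(a - u) \<bullet> z \<le> r" if "z \<in> D" for z
    using ub[OF that] e by (simp add: inner_diff_left)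
  ultimately show ?thesis by (rule that)
qed

text \<open>Splits \<open>a\<close> as \<open>u + (a - u)\<close>, where \<open>u\<close> is paid for by the norm and \<open>a - u\<close> by the constraints
\<open>C *v z \<le> d\<close> through Farkas' lemma.\<close>

lemma polyhedral_norm_multiplier:
  fixes C :: "real ^ 'm ^ 'p"
  assumes N: "is_norm N" and lam: "0 \<le> lam" and d: "0 \<le> d"
    and le: "\<And>z. C *v z \<le> d \<Longrightarrow> a \<bullet> z \<le> r + lam * N z"
  obtains \<gamma> where "0 \<le> \<gamma>" "\<gamma> \<bullet> d \<le> r" "dual_norm N (transpose C *v \<gamma> - a) \<le> lam"
proof -
  have "convex {z. C *v z \<le> d}"
  proof (rule convexI)
    fix x y and s t :: real
    assume xy: "x \<in> {z. C *v z \<le> d}" "y \<in> {z. C *v z \<le> d}" and st: "0 \<le> s" "0 \<le> t" "s + t = 1"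
    have "s * (C *v x) $ i + t * (C *v y) $ i \<le> s * d $ i + t * d $ i" for i
      using xy st by (intro add_mono mult_left_mono) (auto simp: less_eq_vec_def)
    moreover have "s * d $ i + t * d $ i = d $ i" for i
      using st by (simp flip: distrib_right)
    ultimately show "s *\<^sub>R x + t *\<^sub>R y \<in> {z. C *v z \<le> d}"
      by (simp add: less_eq_vec_def matrix_vector_right_distrib matrix_vector_mult_scaleR)
  qed
  moreover have "{z. C *v z \<le> d} \<noteq> {}" using d by (auto intro: exI[of _ 0])
  ultimately obtain u where u: "\<And>z. u \<bullet> z \<le> lam * N z"
      "\<And>z. C *v z \<le> d \<Longrightarrow> (a - u) \<bullet> z \<le> r"
    using linear_between_norm_and_affine[OF N lam, of "{z. C *v z \<le> d}" a r] le by auto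
  obtain \<gamma> where \<gamma>: "0 \<le> \<gamma>" "transpose C *v \<gamma> = a - u" "\<gamma> \<bullet> d \<le> r"
    using affine_farkas[OF d u(2)] by metis
  have "dual_norm N (- u) \<le> lam"
    unfolding dual_norm_le_iff[OF N] using lam u(1)[of "- z" for z] is_norm_minus[OF N] by simp
  then show ?thesis using that[of \<gamma>] \<gamma> by simp
qed

section \<open>The Wasserstein ball around a finitely supported distribution\<close>

lemma borel_on_measurable:
  "f \<in> borel_measurable borel \<Longrightarrow> f \<in> borel_measurable (borel_on Xi)"
  by (rule measurable_restrict_space1)

lemma is_norm_diff_measurable:
  fixes N :: "'a::euclidean_space \<Rightarrow> real"
  assumes "is_norm N"
  shows "(\<lambda>x. N (fst x - snd x)) \<in> borel_measurable (borel_on Xi \<Otimes>\<^sub>M borel_on Xi)"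
proof -
  have id: "(\<lambda>x. x) \<in> borel_measurable (borel_on Xi)"
    by (rule borel_on_measurable) simp
  show ?thesis
    by (intro measurable_compose[OF _ is_norm_borel_measurable[OF assms]] borel_measurable_diff
        measurable_compose[OF measurable_fst id] measurable_compose[OF measurable_snd id])
qed

text \<open>A pair of random points \<open>(z, y)\<close> on a common finite probability space is itself a coupling. These
are the only members of the ball that the lower bound on the worst-case expectation requires.\<close>

lemma discrete_plan_in_wasserstein_ball:
  fixes N :: "'a::euclidean_space \<Rightarrow> real" and r :: "'b pmf"
  assumes N: "is_norm N" and fin: "finite (set_pmf r)"
    and z: "\<And>k. z k \<in> Xi" and y: "\<And>k. y k \<in> Xi"
    and cost: "(\<integral>k. N (z k - y k) \<partial>r) \<le> \<epsilon>"
  shows "distr r (borel_on Xi) z \<in> wasserstein_ball N Xi \<epsilon> (distr r (borel_on Xi) y)"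
proof -
  let ?B = "borel_on Xi"
  have zm: "z \<in> r \<rightarrow>\<^sub>M ?B" and ym: "y \<in> r \<rightarrow>\<^sub>M ?B"
    and zym: "(\<lambda>k. (z k, y k)) \<in> r \<rightarrow>\<^sub>M ?B \<Otimes>\<^sub>M ?B"
    using z y by (auto simp: space_pair_measure space_restrict_space)
  define \<kappa> where "\<kappa> = distr r (?B \<Otimes>\<^sub>M ?B) (\<lambda>k. (z k, y k))"
  have \<kappa>: "\<kappa> \<in> couplings Xi (distr r ?B z) (distr r ?B y)"
    unfolding couplings_def \<kappa>_def
    by (auto intro!: measure_pmf.prob_space_distr zym simp: distr_distr[OF _ zym] comp_def)
  have "(\<integral>\<^sup>+ (\<xi>, \<xi>'). ennreal (N (\<xi> - \<xi>')) \<partial>\<kappa>) = (\<integral>\<^sup>+ k. ennreal (N (z k - y k)) \<partial>r)"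
    unfolding \<kappa>_def split_beta
    using is_norm_diff_measurable[OF N] by (subst nn_integral_distr[OF zym]) auto
  also have "\<dots> = ennreal (\<integral>k. N (z k - y k) \<partial>r)"
    by (intro nn_integral_eq_integral integrable_measure_pmf_finite fin)
       (simp add: is_norm_nonneg[OF N])
  also have "\<dots> \<le> ennreal \<epsilon>" using cost by (rule ennreal_leI)
  finally have "wasserstein N Xi (distr r ?B y) (distr r ?B z) \<le> ennreal \<epsilon>"
    unfolding wasserstein_def by (rule INF_lower2[OF \<kappa>])
  moreover have "distr r ?B z \<in> finite_mean_distributions N Xi"
  proof -
    have "(\<integral>\<^sup>+ \<xi>. ennreal (N \<xi>) \<partial>distr r ?B z) = (\<integral>\<^sup>+ k. ennreal (N (z k)) \<partial>r)"
      using borel_on_measurable[OF is_norm_borel_measurable[OF N]]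
      by (subst nn_integral_distr[OF zm]) auto
    also have "\<dots> = ennreal (\<integral>k. N (z k) \<partial>r)"
      by (intro nn_integral_eq_integral integrable_measure_pmf_finite fin)
         (simp add: is_norm_nonneg[OF N])
    finally show ?thesis
      by (simp add: finite_mean_distributions_def measure_pmf.prob_space_distr[OF zm])
  qed
  ultimately show ?thesis by (simp add: wasserstein_ball_def)
qed

lemma finite_mean_integrable:
  fixes N :: "'a::euclidean_space \<Rightarrow> real"
  assumes N: "is_norm N" and Q: "Q \<in> finite_mean_distributions N Xi"
    and f: "f \<in> borel_measurable borel"
    and growth: "\<And>\<xi>. \<bar>f \<xi>\<bar> \<le> c + L * N \<xi>"
  shows "integrable Q f"
proof -
  from Q have Q': "prob_space Q" "sets Q = sets (borel_on Xi)" "(\<integral>\<^sup>+ \<xi>. ennreal (N \<xi>) \<partial>Q) < \<infinity>"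
    by (auto simp: finite_mean_distributions_def)
  interpret prob_space Q by fact
  have meas: "g \<in> borel_measurable Q" if "g \<in> borel_measurable borel" for g :: "'a \<Rightarrow> real"
    using borel_on_measurable[OF that, of Xi] measurable_cong_sets[OF Q'(2) refl] by blast
  have "integrable Q N"
    using Q'(3) meas[OF is_norm_borel_measurable[OF N]]
    by (intro integrableI_nonneg) (auto simp: is_norm_nonneg[OF N])
  then have "integrable Q (\<lambda>\<xi>. c + L * N \<xi>)" by simp
  then show ?thesis
    by (rule Bochner_Integration.integrable_bound)
       (auto intro!: meas[OF f] order_trans[OF growth abs_ge_self])
qed

text \<open>Weak duality: integrate the bound on \<open>f \<xi>\<close> against a coupling. Several indices \<open>k\<close> may share the
same atom \<open>y k\<close>, so \<open>s\<close> is not a function of the atom; \<open>S\<close> takes the smallest value available at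
each atom. The infimum in the Wasserstein distance is approached, not assumed to be attained,
whence the slack \<open>\<delta>\<close>.\<close>

lemma wasserstein_ball_integral_le:
  fixes N :: "'a::euclidean_space \<Rightarrow> real" and q :: "'b pmf"
  assumes N: "is_norm N" and fin: "finite (set_pmf q)" and y: "\<And>k. y k \<in> Xi"
    and lam: "0 \<le> lam" and \<epsilon>: "0 \<le> \<epsilon>"
    and f: "f \<in> borel_measurable borel"
    and Q: "Q \<in> wasserstein_ball N Xi \<epsilon> (distr q (borel_on Xi) y)" "integrable Q f"
    and bound: "\<And>k \<xi>. k \<in> set_pmf q \<Longrightarrow> \<xi> \<in> Xi \<Longrightarrow> f \<xi> \<le> s k + lam * N (\<xi> - y k)"
  shows "(\<integral>\<xi>. f \<xi> \<partial>Q) \<le> lam * \<epsilon> + (\<integral>k. s k \<partial>q)"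
proof -
  let ?B = "borel_on Xi"
  let ?P = "distr q ?B y"
  have ym: "y \<in> q \<rightarrow>\<^sub>M ?B" using y by (auto simp: space_restrict_space)
  define Y where "Y = y ` set_pmf q"
  define S where "S \<xi>' = (\<Sum>w\<in>Y. Min (s ` {k \<in> set_pmf q. y k = w}) * indicator {w} \<xi>')" for \<xi>'
  have finY: "finite Y" using fin by (simp add: Y_def)
  have S_eq: "S w = Min (s ` {k \<in> set_pmf q. y k = w})" if "w \<in> Y" for w
    using that finY by (simp add: S_def indicator_def if_distrib sum.delta cong: if_cong)
  have S_le: "S (y k) \<le> s k" if "k \<in> set_pmf q" for k
    using that fin by (subst S_eq) (auto simp: Y_def intro!: Min_le)
  have f_le: "f \<xi> \<le> S w + lam * N (\<xi> - w)" if "w \<in> Y" "\<xi> \<in> Xi" for w \<xi>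
  proof -
    have "Min (s ` {k \<in> set_pmf q. y k = w}) \<in> s ` {k \<in> set_pmf q. y k = w}"
      using that(1) fin by (intro Min_in) (auto simp: Y_def)
    then show ?thesis using bound that S_eq by fastforce
  qed
  have Sm: "S \<in> borel_measurable ?B" unfolding S_def by (rule borel_on_measurable) measurable
  have SP: "integrable ?P S"
    by (subst integrable_distr_eq[OF ym Sm]) (rule integrable_measure_pmf_finite[OF fin])
  have SPle: "(\<integral>w. S w \<partial>?P) \<le> (\<integral>k. s k \<partial>q)"
    by (subst integral_distr[OF ym Sm], intro integral_mono_AE integrable_measure_pmf_finite fin)
       (use S_le in \<open>simp add: AE_measure_pmf_iff\<close>)
  have Ym: "{w \<in> space ?B. w \<in> Y} \<in> sets ?B"
  proof -
    have "Y \<in> sets borel" using finY by (intro borel_closed finite_imp_closed)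
    then show ?thesis by (auto simp: sets_restrict_space space_restrict_space)
  qed
  have PY: "AE w in ?P. w \<in> Y"
    by (rule AE_distr_iff[where P = "\<lambda>w. w \<in> Y", OF ym Ym, THEN iffD2])
       (simp add: AE_measure_pmf_iff Y_def)
  have slack: "(\<integral>\<xi>. f \<xi> \<partial>Q) \<le> lam * (\<epsilon> + \<delta>) + (\<integral>k. s k \<partial>q)" if "\<delta> > 0" for \<delta>
  proof -
    have "wasserstein N Xi ?P Q < ennreal (\<epsilon> + \<delta>)"
    proof (rule le_less_trans)
      show "wasserstein N Xi ?P Q \<le> ennreal \<epsilon>" using Q(1) by (simp add: wasserstein_ball_def)
      show "ennreal \<epsilon> < ennreal (\<epsilon> + \<delta>)" using that \<epsilon> by (intro ennreal_lessI) auto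
    qed
    then obtain \<kappa> where \<kappa>: "\<kappa> \<in> couplings Xi Q ?P"
        "(\<integral>\<^sup>+ (\<xi>, \<xi>'). ennreal (N (\<xi> - \<xi>')) \<partial>\<kappa>) < ennreal (\<epsilon> + \<delta>)"
      by (auto simp: wasserstein_def INF_less_iff)
    from \<kappa>(1) have \<kappa>': "prob_space \<kappa>" "sets \<kappa> = sets (?B \<Otimes>\<^sub>M ?B)" "distr \<kappa> ?B fst = Q"
      "distr \<kappa> ?B snd = ?P" by (auto simp: couplings_def)
    interpret prob_space \<kappa> by fact
    have fstm: "fst \<in> \<kappa> \<rightarrow>\<^sub>M ?B" and sndm: "snd \<in> \<kappa> \<rightarrow>\<^sub>M ?B"
      using measurable_cong_sets[OF \<kappa>'(2) refl] measurable_fst measurable_snd by blast+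
    have Nm: "(\<lambda>x. N (fst x - snd x)) \<in> borel_measurable \<kappa>"
      using measurable_cong_sets[OF \<kappa>'(2) refl] is_norm_diff_measurable[OF N] by blast
    have fm: "f \<in> borel_measurable ?B" using f by (rule borel_on_measurable)
    have fi: "integrable \<kappa> (\<lambda>x. f (fst x))"
      using Q(2) unfolding \<kappa>'(3)[symmetric] by (simp add: integrable_distr_eq[OF fstm fm])
    have Si: "integrable \<kappa> (\<lambda>x. S (snd x))"
      using SP unfolding \<kappa>'(4)[symmetric] by (simp add: integrable_distr_eq[OF sndm Sm])
    have cost: "(\<integral>\<^sup>+ x. ennreal (N (fst x - snd x)) \<partial>\<kappa>) < ennreal (\<epsilon> + \<delta>)"
      using \<kappa>(2) unfolding case_prod_unfold .
    then have "(\<integral>\<^sup>+ x. ennreal (N (fst x - snd x)) \<partial>\<kappa>) < \<infinity>"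
      using ennreal_less_top order.strict_trans unfolding infinity_ennreal_def by blast
    then have Ni: "integrable \<kappa> (\<lambda>x. N (fst x - snd x))"
      using Nm by (intro integrableI_nonneg) (simp_all add: is_norm_nonneg[OF N])
    have "ennreal (\<integral>x. N (fst x - snd x) \<partial>\<kappa>) < ennreal (\<epsilon> + \<delta>)"
      using cost nn_integral_eq_integral[OF Ni] by (simp add: is_norm_nonneg[OF N])
    then have Nle: "(\<integral>x. N (fst x - snd x) \<partial>\<kappa>) \<le> \<epsilon> + \<delta>"
      by (simp add: ennreal_less_iff is_norm_nonneg[OF N] del: ennreal_plus)
    have ae: "AE x in \<kappa>. f (fst x) \<le> S (snd x) + lam * N (fst x - snd x)"
    proof -
      have "AE x in \<kappa>. snd x \<in> Y"
        using PY unfolding \<kappa>'(4)[symmetric]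
        by (rule AE_distr_iff[where P = "\<lambda>w. w \<in> Y", OF sndm Ym, THEN iffD1])
      moreover have "AE x in \<kappa>. fst x \<in> Xi"
        using measurable_space[OF fstm] by (auto simp: space_restrict_space)
      ultimately show ?thesis by eventually_elim (rule f_le)
    qed
    have "(\<integral>\<xi>. f \<xi> \<partial>Q) = (\<integral>x. f (fst x) \<partial>\<kappa>)"
      unfolding \<kappa>'(3)[symmetric] by (rule integral_distr[OF fstm fm])
    also have "\<dots> \<le> (\<integral>x. S (snd x) + lam * N (fst x - snd x) \<partial>\<kappa>)"
      using ae Si Ni fi by (intro integral_mono_AE) auto
    also have "\<dots> = (\<integral>x. S (snd x) \<partial>\<kappa>) + lam * (\<integral>x. N (fst x - snd x) \<partial>\<kappa>)"
      using Si Ni by simp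
    also have "(\<integral>x. S (snd x) \<partial>\<kappa>) = (\<integral>w. S w \<partial>?P)"
      unfolding \<kappa>'(4)[symmetric] by (rule integral_distr[OF sndm Sm, symmetric])
    finally show ?thesis using SPle mult_left_mono[OF Nle lam] by linarith
  qed
  show ?thesis
  proof (rule field_le_epsilon)
    fix e :: real assume e: "0 < e"
    have "lam * (e / (lam + 1)) \<le> e" using e lam by (simp add: field_simps)
    then show "(\<integral>\<xi>. f \<xi> \<partial>Q) \<le> lam * \<epsilon> + (\<integral>k. s k \<partial>q) + e"
      using slack[of "e / (lam + 1)"] e lam by (simp add: distrib_left)
  qed
qed

section \<open>Strong duality for Lipschitz integrands\<close>

text \<open>Think of \<open>c\<close> as the cost and \<open>v\<close> as the gain of a plan. If no mixture of two plans within the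
budget \<open>\<epsilon>\<close> gains more than \<open>V\<close>, then a line of slope \<open>lam\<close> through \<open>(\<epsilon>, V)\<close> lies above all plans:
take the steepest slope from \<open>(\<epsilon>, V)\<close> to a plan over budget. It is finite: for \<open>\<epsilon> > 0\<close> by comparison
with the free plan \<open>x0\<close>, and for \<open>\<epsilon> = 0\<close>, where no plan is strictly within budget, by the
Lipschitz bound.\<close>

lemma supergradient_of_mixtures:
  fixes c v :: "'s \<Rightarrow> real"
  assumes \<epsilon>: "0 \<le> \<epsilon>" and x0: "x0 \<in> T" "c x0 = 0"
    and L: "0 \<le> L" "\<And>x. x \<in> T \<Longrightarrow> v x \<le> v x0 + L * c x"
    and c: "\<And>x. x \<in> T \<Longrightarrow> 0 \<le> c x"
    and mix: "\<And>x x' p. x \<in> T \<Longrightarrow> x' \<in> T \<Longrightarrow> 0 \<le> p \<Longrightarrow> p \<le> 1 \<Longrightarrow>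
      p * c x + (1 - p) * c x' \<le> \<epsilon> \<Longrightarrow> p * v x + (1 - p) * v x' \<le> V"
  obtains lam where "0 \<le> lam" "\<And>x. x \<in> T \<Longrightarrow> v x \<le> V + lam * (c x - \<epsilon>)"
proof -
  define R where "R = insert 0 ((\<lambda>x. (v x - V) / (c x - \<epsilon>)) ` {x \<in> T. \<epsilon> < c x})"
  have single: "v x \<le> V" if "x \<in> T" "c x \<le> \<epsilon>" for x
    using mix[of x x 1] that by simp
  \<comment> \<open>A chord from a point left of \<open>\<epsilon>\<close> to one right of \<open>\<epsilon>\<close> passes at or below \<open>V\<close> at \<open>\<epsilon>\<close>.\<close>
  have chord: "(v x - V) / (c x - \<epsilon>) \<le> (V - v w) / (\<epsilon> - c w)"
    if x: "x \<in> T" "\<epsilon> < c x" and w: "w \<in> T" "c w < \<epsilon>" for x w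
  proof -
    define p where "p = (\<epsilon> - c w) / (c x - c w)"
    have p: "0 \<le> p" "p \<le> 1" "1 - p = (c x - \<epsilon>) / (c x - c w)"
      using x w by (auto simp: p_def field_simps)
    have "p * c x + (1 - p) * c w = ((\<epsilon> - c w) * c x + (c x - \<epsilon>) * c w) / (c x - c w)"
      unfolding p(3) by (simp add: p_def add_divide_distrib)
    also have "\<dots> = (\<epsilon> * (c x - c w)) / (c x - c w)" by (simp add: algebra_simps)
    also have "\<dots> = \<epsilon>" using x w by simp
    finally have "p * v x + (1 - p) * v w \<le> V" using mix[OF x(1) w(1) p(1,2)] by simp
    moreover have "p * v x + (1 - p) * v w = ((\<epsilon> - c w) * v x + (c x - \<epsilon>) * v w) / (c x - c w)"
      unfolding p(3) by (simp add: p_def add_divide_distrib)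
    ultimately have "(\<epsilon> - c w) * v x + (c x - \<epsilon>) * v w \<le> V * (c x - c w)"
      using x w by (simp add: pos_divide_le_eq)
    then have "(v x - V) * (\<epsilon> - c w) \<le> (V - v w) * (c x - \<epsilon>)" by (simp add: algebra_simps)
    then show ?thesis using x w by (simp add: pos_divide_le_eq pos_le_divide_eq field_simps)
  qed
  have bdd: "bdd_above R"
  proof -
    have "\<exists>b\<ge>0. \<forall>x\<in>T. \<epsilon> < c x \<longrightarrow> (v x - V) / (c x - \<epsilon>) \<le> b"
    proof (cases "\<epsilon> = 0")
      case True
      have "(v x - V) / (c x - \<epsilon>) \<le> L" if "x \<in> T" "\<epsilon> < c x" for x
        using single[OF x0(1)] x0(2) L(2)[OF that(1)] that(2) True by (simp add: pos_divide_le_eq)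
      then show ?thesis using L(1) by blast
    next
      case False
      then have "(v x - V) / (c x - \<epsilon>) \<le> (V - v x0) / (\<epsilon> - c x0)" if "x \<in> T" "\<epsilon> < c x" for x
        using chord[OF that x0(1)] x0(2) \<epsilon> by simp
      moreover have "0 \<le> (V - v x0) / (\<epsilon> - c x0)" using single[OF x0(1)] x0(2) \<epsilon> by simp
      ultimately show ?thesis by blast
    qed
    then show ?thesis by (auto simp: R_def bdd_above_def)
  qed
  have nonneg: "0 \<le> Sup R" using cSup_upper[OF _ bdd, of 0] by (simp add: R_def)
  moreover have "v x \<le> V + Sup R * (c x - \<epsilon>)" if x: "x \<in> T" for x
  proof (cases "c x" \<epsilon> rule: linorder_cases)
    case less
    have "Sup R \<le> (V - v x) / (\<epsilon> - c x)"
      using chord[OF _ _ x less] single[OF x] less by (intro cSup_least) (auto simp: R_def)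
    then show ?thesis using less by (simp add: pos_le_divide_eq algebra_simps)
  next
    case equal
    then show ?thesis using single[OF x] by simp
  next
    case greater
    then have "(v x - V) / (c x - \<epsilon>) \<le> Sup R"
      using x by (intro cSup_upper[OF _ bdd]) (auto simp: R_def)
    then show ?thesis using greater by (simp add: pos_divide_le_eq algebra_simps)
  qed
  ultimately show ?thesis by (rule that)
qed

text \<open>Over a finite probability space the choices \<open>z k\<close> are independent, so suprema and integral can be
interchanged by picking near-optimal points.\<close>

lemma integral_SUP_le:
  fixes q :: "'b pmf" and \<phi> :: "'b \<Rightarrow> 'a \<Rightarrow> real"
  assumes fin: "finite (set_pmf q)" and ne: "A \<noteq> {}"
    and bdd: "\<And>k. bdd_above (\<phi> k ` A)"
    and le: "\<And>z. (\<And>k. z k \<in> A) \<Longrightarrow> (\<integral>k. \<phi> k (z k) \<partial>q) \<le> B"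
  shows "(\<integral>k. (SUP \<xi>\<in>A. \<phi> k \<xi>) \<partial>q) \<le> B"
proof (rule field_le_epsilon)
  fix e :: real assume e: "0 < e"
  have "\<forall>k. \<exists>\<xi>\<in>A. (SUP \<xi>\<in>A. \<phi> k \<xi>) - e < \<phi> k \<xi>"
  proof
    fix k
    have "(SUP \<xi>\<in>A. \<phi> k \<xi>) - e < (SUP \<xi>\<in>A. \<phi> k \<xi>)" using e by simp
    then show "\<exists>\<xi>\<in>A. (SUP \<xi>\<in>A. \<phi> k \<xi>) - e < \<phi> k \<xi>" using less_cSUP_iff[OF ne bdd] by blast
  qed
  then obtain z where z: "\<And>k. z k \<in> A" "\<And>k. (SUP \<xi>\<in>A. \<phi> k \<xi>) - e < \<phi> k (z k)" by metis
  have "(\<integral>k. (SUP \<xi>\<in>A. \<phi> k \<xi>) - e \<partial>q) \<le> (\<integral>k. \<phi> k (z k) \<partial>q)"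
    by (intro integral_mono integrable_measure_pmf_finite fin less_imp_le z)
  also have "\<dots> \<le> B" by (rule le) (rule z)
  finally show "(\<integral>k. (SUP \<xi>\<in>A. \<phi> k \<xi>) \<partial>q) \<le> B + e"
    by (simp add: Bochner_Integration.integral_diff integrable_measure_pmf_finite[OF fin])
qed

text \<open>Here a plan moves each atom \<open>y k\<close> to a single point \<open>z k\<close>. A mixture of two plans is a distribution
in the ball, realised by an independent coin toss, so there is a price \<open>lam\<close> for transport.
With transport priced, the atoms no longer share a budget and
may be optimised one at a time, which yields \<open>s k\<close>.\<close>

lemma dual_certificate_exists:
  fixes N :: "'a::euclidean_space \<Rightarrow> real" and q :: "'b pmf"
  assumes N: "is_norm N" and fin: "finite (set_pmf q)" and y: "\<And>k. y k \<in> Xi"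
    and \<epsilon>: "0 \<le> \<epsilon>" and f: "f \<in> borel_measurable borel"
    and L: "0 \<le> L" "\<And>\<xi> \<xi>'. f \<xi> \<le> f \<xi>' + L * N (\<xi> - \<xi>')"
    and V: "\<And>Q. Q \<in> wasserstein_ball N Xi \<epsilon> (distr q (borel_on Xi) y) \<Longrightarrow> (\<integral>\<xi>. f \<xi> \<partial>Q) \<le> V"
  obtains lam s where "0 \<le> lam" "\<And>k \<xi>. \<xi> \<in> Xi \<Longrightarrow> f \<xi> \<le> s k + lam * N (\<xi> - y k)"
    "lam * \<epsilon> + (\<integral>k. s k \<partial>q) \<le> V"
proof -
  define T where "T = {z :: 'b \<Rightarrow> 'a. \<forall>k. z k \<in> Xi}"
  define c where "c z = (\<integral>k. N (z k - y k) \<partial>q)" for z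
  define v where "v z = (\<integral>k. f (z k) \<partial>q)" for z
  note int = integrable_measure_pmf_finite[OF fin]
  have mix: "p * v z + (1 - p) * v z' \<le> V"
    if z: "z \<in> T" "z' \<in> T" and p: "0 \<le> p" "p \<le> 1" and cost: "p * c z + (1 - p) * c z' \<le> \<epsilon>"
    for z z' p
  proof -
    define r where "r = pair_pmf q (bernoulli_pmf p)"
    define zz where "zz = (\<lambda>(k, b). if b then z k else z' k)"
    have finr: "finite (set_pmf r)" using fin by (simp add: r_def)
    have mixture: "(\<integral>x. F x \<partial>r) = p * (\<integral>k. F (k, True) \<partial>q) + (1 - p) * (\<integral>k. F (k, False) \<partial>q)"
      for F :: "'b \<times> bool \<Rightarrow> real"
    proof -
      have "(\<integral>x. F x \<partial>r) = (\<Sum>x\<in>set_pmf q \<times> UNIV. F x * pmf r x)"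
        using fin by (intro integral_measure_pmf_real) (auto simp: r_def)
      also have "\<dots> = (\<Sum>k\<in>set_pmf q. \<Sum>b\<in>UNIV. F (k, b) * pmf r (k, b))"
        by (simp add: sum.cartesian_product)
      also have "\<dots> = (\<Sum>k\<in>set_pmf q. p * (F (k, True) * pmf q k) + (1 - p) * (F (k, False) * pmf q k))"
        using p by (intro sum.cong) (auto simp: r_def pmf_pair UNIV_bool)
      also have "\<dots> = p * (\<Sum>k\<in>set_pmf q. F (k, True) * pmf q k)
          + (1 - p) * (\<Sum>k\<in>set_pmf q. F (k, False) * pmf q k)"
        by (simp add: sum.distrib sum_distrib_left)
      finally show ?thesis using fin by (simp add: integral_measure_pmf_real[of "set_pmf q"])
    qed
    have zz: "zz x \<in> Xi" for x using z by (auto simp: zz_def T_def split_beta)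
    have zzm: "zz \<in> r \<rightarrow>\<^sub>M borel_on Xi" using zz by (auto simp: space_restrict_space)
    have ym: "y \<in> q \<rightarrow>\<^sub>M borel_on Xi" "y \<in> count_space UNIV \<rightarrow>\<^sub>M borel_on Xi"
      using y by (auto simp: space_restrict_space)
    have "distr q (borel_on Xi) y = distr (map_pmf fst r) (borel_on Xi) y"
      by (simp add: r_def map_fst_pair_pmf)
    also have "\<dots> = distr r (borel_on Xi) (\<lambda>x. y (fst x))"
      unfolding map_pmf_rep_eq by (subst distr_distr[OF ym(2)]) (auto simp: comp_def)
    finally have centre: "distr q (borel_on Xi) y = distr r (borel_on Xi) (\<lambda>x. y (fst x))" .
    have "distr r (borel_on Xi) zz \<in> wasserstein_ball N Xi \<epsilon> (distr q (borel_on Xi) y)"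
      unfolding centre using cost
      by (intro discrete_plan_in_wasserstein_ball[where z = zz and y = "\<lambda>x. y (fst x)"] N finr zz y)
         (simp add: mixture zz_def c_def)
    then have "(\<integral>\<xi>. f \<xi> \<partial>distr r (borel_on Xi) zz) \<le> V" by (rule V)
    also have "(\<integral>\<xi>. f \<xi> \<partial>distr r (borel_on Xi) zz) = (\<integral>x. f (zz x) \<partial>r)"
      by (rule integral_distr[OF zzm borel_on_measurable[OF f]])
    finally show ?thesis by (simp add: mixture zz_def v_def)
  qed
  have yT: "y \<in> T" using y by (simp add: T_def)
  have cy: "c y = 0" by (simp add: c_def is_norm_zero[OF N])
  have vL: "v z \<le> v y + L * c z" for z
  proof -
    have "v z \<le> (\<integral>k. f (y k) + L * N (z k - y k) \<partial>q)"
      unfolding v_def by (intro integral_mono int L)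
    then show ?thesis
      by (simp add: v_def c_def Bochner_Integration.integral_add[OF int int])
  qed
  have c0: "0 \<le> c z" for z unfolding c_def by (simp add: is_norm_nonneg[OF N])
  obtain lam where lam: "0 \<le> lam" "\<And>z. z \<in> T \<Longrightarrow> v z \<le> V + lam * (c z - \<epsilon>)"
    using supergradient_of_mixtures[where v = v and V = V, OF \<epsilon> yT cy L(1) vL c0 mix] by blast
  define \<phi> where "\<phi> k \<xi> = f \<xi> - lam * N (\<xi> - y k)" for k \<xi>
  have total: "(\<integral>k. \<phi> k (z k) \<partial>q) \<le> V - lam * \<epsilon>" if "\<And>k. z k \<in> Xi" for z
    using lam(2)[of z] that
    by (simp add: \<phi>_def T_def c_def v_def Bochner_Integration.integral_diff[OF int int]
        right_diff_distrib)
  have bdd: "bdd_above (\<phi> k ` Xi)" for k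
  proof -
    \<comment> \<open>Moving only an atom of positive mass bounds \<open>\<phi> k0\<close>. The triangle inequality carries
      the bound over to the other atoms, even those of mass zero.\<close>
    obtain k0 where k0: "k0 \<in> set_pmf q" using set_pmf_not_empty[of q] by blast
    define rest where "rest = (\<Sum>k\<in>set_pmf q - {k0}. \<phi> k (y k) * pmf q k)"
    have one: "\<phi> k0 \<xi> \<le> (V - lam * \<epsilon> - rest) / pmf q k0" if "\<xi> \<in> Xi" for \<xi>
    proof -
      have "(\<integral>k. \<phi> k ((y(k0 := \<xi>)) k) \<partial>q) \<le> V - lam * \<epsilon>" by (rule total) (use that y in simp)
      also have "(\<integral>k. \<phi> k ((y(k0 := \<xi>)) k) \<partial>q) = (\<Sum>k\<in>set_pmf q. \<phi> k ((y(k0 := \<xi>)) k) * pmf q k)"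
        using fin by (intro integral_measure_pmf_real)
      also have "\<dots> = \<phi> k0 \<xi> * pmf q k0 + rest"
        unfolding rest_def by (subst sum.remove[OF fin k0]) simp
      finally show ?thesis using pmf_positive[OF k0] by (simp add: pos_le_divide_eq)
    qed
    show ?thesis
    proof (rule bdd_aboveI2)
      fix \<xi> assume "\<xi> \<in> Xi"
      have "N (\<xi> - y k0) \<le> N (\<xi> - y k) + N (y k - y k0)"
        using is_norm_triangle[OF N, of "\<xi> - y k" "y k - y k0"] by simp
      from mult_left_mono[OF this lam(1)]
      show "\<phi> k \<xi> \<le> (V - lam * \<epsilon> - rest) / pmf q k0 + lam * N (y k - y k0)"
        using one[OF \<open>\<xi> \<in> Xi\<close>] by (simp add: \<phi>_def distrib_left)
    qed
  qed
  define s where "s k = (SUP \<xi>\<in>Xi. \<phi> k \<xi>)" for k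
  have "f \<xi> \<le> s k + lam * N (\<xi> - y k)" if "\<xi> \<in> Xi" for k \<xi>
    using cSUP_upper[OF that bdd, of k] by (simp add: s_def \<phi>_def)
  moreover have "lam * \<epsilon> + (\<integral>k. s k \<partial>q) \<le> V"
  proof -
    have "Xi \<noteq> {}" using y by blast
    then have "(\<integral>k. s k \<partial>q) \<le> V - lam * \<epsilon>"
      unfolding s_def by (rule integral_SUP_le[where \<phi> = \<phi>, OF fin _ bdd total])
    then show ?thesis by simp
  qed
  ultimately show ?thesis using lam(1) that by blast
qed

text \<open>The Lipschitz bound makes \<open>f\<close> integrable over the ball and makes the dual problem feasible (take
\<open>lam = L\<close> and \<open>s k = f (y k)\<close>), so that the worst-case expectation is not infinite.\<close>

lemma worst_case_expectation_dual:
  fixes N :: "'a::euclidean_space \<Rightarrow> real" and q :: "'b pmf"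
  assumes N: "is_norm N" and fin: "finite (set_pmf q)" and y: "\<And>k. y k \<in> Xi"
    and \<epsilon>: "0 \<le> \<epsilon>" and f: "f \<in> borel_measurable borel"
    and L: "0 \<le> L" "\<And>\<xi> \<xi>'. f \<xi> \<le> f \<xi>' + L * N (\<xi> - \<xi>')"
  shows "worst_case_expectation N Xi \<epsilon> (distr q (borel_on Xi) y) f =
    (INF (lam, s)\<in>{(lam, s). 0 \<le> lam \<and> (\<forall>k. \<forall>\<xi>\<in>Xi. f \<xi> \<le> s k + lam * N (\<xi> - y k))}.
      ereal (lam * \<epsilon> + (\<integral>k. s k \<partial>q)))" (is "?V = (INF (lam, s)\<in>?D. ?obj lam s)")
proof (rule antisym)
  have int: "integrable Q f" if "Q \<in> wasserstein_ball N Xi \<epsilon> (distr q (borel_on Xi) y)" for Q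
  proof (rule finite_mean_integrable[OF N _ f])
    show "Q \<in> finite_mean_distributions N Xi" using that by (simp add: wasserstein_ball_def)
    show "\<bar>f \<xi>\<bar> \<le> \<bar>f 0\<bar> + L * N \<xi>" for \<xi>
      using L(2)[of \<xi> 0] L(2)[of 0 \<xi>] by (simp add: is_norm_minus[OF N])
  qed
  have weak: "?V \<le> ?obj lam s" if "(lam, s) \<in> ?D" for lam s
    unfolding worst_case_expectation_def
  proof (rule SUP_least)
    fix Q assume Q: "Q \<in> wasserstein_ball N Xi \<epsilon> (distr q (borel_on Xi) y)"
    from that have lam: "0 \<le> lam"
      and bound: "\<And>k \<xi>. \<xi> \<in> Xi \<Longrightarrow> f \<xi> \<le> s k + lam * N (\<xi> - y k)" by auto
    show "ereal (\<integral>\<xi>. f \<xi> \<partial>Q) \<le> ?obj lam s"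
      using wasserstein_ball_integral_le[where y = y and s = s, OF N fin y lam \<epsilon> f Q int[OF Q] bound]
      by simp
  qed
  then show "?V \<le> (INF (lam, s)\<in>?D. ?obj lam s)" by (auto intro!: INF_greatest)
  show "(INF (lam, s)\<in>?D. ?obj lam s) \<le> ?V"
  proof -
    have "distr q (borel_on Xi) y \<in> wasserstein_ball N Xi \<epsilon> (distr q (borel_on Xi) y)"
      by (rule discrete_plan_in_wasserstein_ball[where y = y and z = y, OF N fin y y]) (simp add: is_norm_zero[OF N] \<epsilon>)
    then have "ereal (\<integral>\<xi>. f \<xi> \<partial>distr q (borel_on Xi) y) \<le> ?V"
      unfolding worst_case_expectation_def by (rule SUP_upper)
    then have "?V \<noteq> - \<infinity>" by auto
    moreover have "(L, \<lambda>k. f (y k)) \<in> ?D" using L by auto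
    then have "?V \<le> ereal (L * \<epsilon> + (\<integral>k. f (y k) \<partial>q))" by (rule weak)
    then have "?V \<noteq> \<infinity>" by auto
    ultimately obtain V where V: "?V = ereal V" by (cases ?V) auto
    have bound: "(\<integral>\<xi>. f \<xi> \<partial>Q) \<le> V" if "Q \<in> wasserstein_ball N Xi \<epsilon> (distr q (borel_on Xi) y)" for Q
    proof -
      have "ereal (\<integral>\<xi>. f \<xi> \<partial>Q) \<le> ?V"
        unfolding worst_case_expectation_def by (rule SUP_upper[OF that])
      then show ?thesis by (simp add: V)
    qed
    obtain lam s where "0 \<le> lam" "\<And>k \<xi>. \<xi> \<in> Xi \<Longrightarrow> f \<xi> \<le> s k + lam * N (\<xi> - y k)"
        "lam * \<epsilon> + (\<integral>k. s k \<partial>q) \<le> V"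
      using dual_certificate_exists[where y = y, OF N fin y \<epsilon> f L bound] by metis
    then show ?thesis unfolding V by (intro INF_lower2[of "(lam, s)"]) auto
  qed
qed

section \<open>Piecewise affine losses on a polyhedron\<close>

text \<open>Presents the weighted empirical distribution as the image of a distribution on index pairs, so that
the duality for finitely supported distributions applies. The map \<open>y\<close> must take values in \<open>Xi\<close> also
at index pairs out of range; they have probability zero.\<close>

lemma weighted_empirical_eq_distr_pmf:
  fixes xi :: "nat \<Rightarrow> nat \<Rightarrow> 'a::euclidean_space"
  assumes I: "0 < I" and t: "\<And>h. h \<in> {1..H} \<Longrightarrow> 0 \<le> t h" "(\<Sum>h=1..H. t h) = 1"
    and y: "\<And>k. y k \<in> Xi"
    and xi: "\<And>h i. h \<in> {1..H} \<Longrightarrow> i \<in> {1..I} \<Longrightarrow> y (h, i) = xi h i"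
  obtains q :: "(nat \<times> nat) pmf"
  where "set_pmf q \<subseteq> {1..H} \<times> {1..I}"
    "weighted_empirical Xi H I t xi = distr q (borel_on Xi) y"
    "\<And>s :: nat \<times> nat \<Rightarrow> real. (\<integral>k. s k \<partial>q) = (\<Sum>h=1..H. \<Sum>i=1..I. t h / real I * s (h, i))"
proof -
  define K where "K = {1..H} \<times> {1..I}"
  define w where "w k = (if k \<in> K then t (fst k) / real I else 0)" for k
  have finK: "finite K" by (simp add: K_def)
  have w0: "0 \<le> w k" for k using t(1) by (auto simp: w_def K_def)
  have flat: "(\<Sum>k\<in>K. F k) = (\<Sum>h=1..H. \<Sum>i=1..I. F (h, i))" for F :: "nat \<times> nat \<Rightarrow> 'c::comm_monoid_add"
    by (simp only: K_def sum.cartesian_product case_prod_eta)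
  have w_eq: "w (h, i) = t h / real I" if "h \<in> {1..H}" "i \<in> {1..I}" for h i
    using that by (simp add: w_def K_def)
  have "(\<integral>\<^sup>+ k. ennreal (w k) \<partial>count_space UNIV) = (\<Sum>k\<in>K. ennreal (w k))"
    by (rule nn_integral_count_space'[OF finK]) (auto simp: w_def)
  also have "\<dots> = ennreal (\<Sum>k\<in>K. w k)" using w0 by simp
  also have "(\<Sum>k\<in>K. w k) = (\<Sum>h=1..H. \<Sum>i=1..I. t h / real I)"
    unfolding flat by (intro sum.cong refl) (simp add: w_eq)
  also have "\<dots> = 1" using I t(2) by simp
  finally have total: "(\<integral>\<^sup>+ k. ennreal (w k) \<partial>count_space UNIV) = 1" by simp
  define q where "q = embed_pmf w"
  have pmfq: "pmf q k = w k" for k unfolding q_def by (rule pmf_embed_pmf[OF w0 total])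
  have setq: "set_pmf q \<subseteq> K" unfolding set_pmf_eq by (auto simp: pmfq w_def)
  have ym: "y \<in> q \<rightarrow>\<^sub>M borel_on Xi" using y by (auto simp: space_restrict_space)
  have "weighted_empirical Xi H I t xi = distr q (borel_on Xi) y"
  proof (rule measure_eqI)
    fix A assume "A \<in> sets (weighted_empirical Xi H I t xi)"
    then have A: "A \<in> sets (borel_on Xi)" by simp
    have "emeasure (distr q (borel_on Xi) y) A = (\<integral>\<^sup>+ k. indicator A (y k) \<partial>q)"
      by (simp add: emeasure_distr[OF ym A] nn_integral_indicator[symmetric] indicator_vimage
          del: nn_integral_indicator)
    also have "\<dots> = (\<Sum>k\<in>K. indicator A (y k) * ennreal (pmf q k))"
      using setq by (intro nn_integral_measure_pmf_support finK) auto
    also have "\<dots> = (\<Sum>h=1..H. \<Sum>i=1..I. indicator A (y (h, i)) * ennreal (t h / real I))"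
      unfolding flat by (intro sum.cong refl) (simp add: pmfq w_eq)
    also have "\<dots> = (\<Sum>h=1..H. \<Sum>i=1..I. ennreal (t h / real I) * indicator A (xi h i))"
      using xi by (intro sum.cong) (auto simp: mult.commute)
    also have "\<dots> = emeasure (weighted_empirical Xi H I t xi) A"
      by (simp add: emeasure_weighted_empirical[OF A] emeasure_return[OF A] sum_distrib_left)
    finally show "emeasure (weighted_empirical Xi H I t xi) A
      = emeasure (distr q (borel_on Xi) y) A" by simp
  qed simp
  moreover have "(\<integral>k. s k \<partial>q) = (\<Sum>h=1..H. \<Sum>i=1..I. t h / real I * s (h, i))"
    for s :: "nat \<times> nat \<Rightarrow> real"
  proof -
    have "(\<integral>k. s k \<partial>q) = (\<Sum>k\<in>K. s k * pmf q k)"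
      using setq by (intro integral_measure_pmf_real finK) auto
    also have "\<dots> = (\<Sum>h=1..H. \<Sum>i=1..I. t h / real I * s (h, i))"
      unfolding flat by (intro sum.cong refl) (simp add: pmfq w_eq)
    finally show ?thesis .
  qed
  ultimately show ?thesis using that setq unfolding K_def by blast
qed

lemma worst_case_expectation_cong:
  assumes "\<And>\<xi>. \<xi> \<in> Xi \<Longrightarrow> f \<xi> = g \<xi>"
  shows "worst_case_expectation N Xi \<epsilon> P f = worst_case_expectation N Xi \<epsilon> P g"
proof -
  have "(\<integral>\<xi>. f \<xi> \<partial>Q) = (\<integral>\<xi>. g \<xi> \<partial>Q)" if "Q \<in> wasserstein_ball N Xi \<epsilon> P" for Q
  proof -
    have "space Q = Xi"
      using that sets_eq_imp_space_eq[of Q "borel_on Xi"]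
      by (auto simp: wasserstein_ball_def finite_mean_distributions_def space_restrict_space)
    then show ?thesis using assms by (intro Bochner_Integration.integral_cong) auto
  qed
  then show ?thesis unfolding worst_case_expectation_def by (intro SUP_cong) auto
qed

lemma Max_affine_lipschitz:
  fixes N :: "'a::euclidean_space \<Rightarrow> real"
  assumes N: "is_norm N" and J: "finite J" "J \<noteq> {}"
  obtains L where "0 \<le> L"
    "\<And>\<xi> \<xi>'. (MAX j\<in>J. a j \<bullet> \<xi> + b j) \<le> (MAX j\<in>J. a j \<bullet> \<xi>' + b j) + L * N (\<xi> - \<xi>')"
proof -
  have "\<forall>j. \<exists>L\<ge>0. \<forall>z. a j \<bullet> z \<le> L * N z" using inner_le_is_norm[OF N] by metis
  then obtain c where c: "\<And>j. 0 \<le> c j" "\<And>j z. a j \<bullet> z \<le> c j * N z" by metis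
  have "(MAX j\<in>J. a j \<bullet> \<xi> + b j) \<le> (MAX j\<in>J. a j \<bullet> \<xi>' + b j) + sum c J * N (\<xi> - \<xi>')" for \<xi> \<xi>'
  proof (rule Max.boundedI)
    fix x assume "x \<in> (\<lambda>j. a j \<bullet> \<xi> + b j) ` J"
    then obtain j where j: "j \<in> J" "x = a j \<bullet> \<xi> + b j" by blast
    have "x = (a j \<bullet> \<xi>' + b j) + a j \<bullet> (\<xi> - \<xi>')" by (simp add: j inner_diff_right)
    also have "\<dots> \<le> (MAX j\<in>J. a j \<bullet> \<xi>' + b j) + c j * N (\<xi> - \<xi>')"
      using j J c(2) by (intro add_mono Max_ge) auto
    also have "c j * N (\<xi> - \<xi>') \<le> sum c J * N (\<xi> - \<xi>')"
      using J j c(1) by (intro mult_right_mono member_le_sum is_norm_nonneg[OF N]) auto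
    finally show "x \<le> (MAX j\<in>J. a j \<bullet> \<xi>' + b j) + sum c J * N (\<xi> - \<xi>')" by simp
  qed (use J in auto)
  then show ?thesis using that[of "sum c J"] c(1) by (simp add: sum_nonneg)
qed

text \<open>Writing \<open>a = transpose C *v \<gamma> - (transpose C *v \<gamma> - a)\<close>, the first part of \<open>a \<bullet> (\<xi> - \<xi>')\<close> is at most
\<open>\<gamma> \<bullet> (g - C *v \<xi>')\<close> by feasibility of \<open>\<xi>\<close>, and the second at most \<open>lam * N (\<xi> - \<xi>')\<close>.\<close>

lemma dual_feasible_imp_bound:
  fixes C :: "real ^ 'm ^ 'p" and \<gamma> g :: "real ^ 'p"
  assumes N: "is_norm N" and \<xi>: "C *v \<xi> \<le> g" and \<gamma>: "0 \<le> \<gamma>"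
    and dn: "dual_norm N (transpose C *v \<gamma> - a) \<le> lam"
    and s: "b + a \<bullet> \<xi>' + \<gamma> \<bullet> (g - C *v \<xi>') \<le> s"
  shows "a \<bullet> \<xi> + b \<le> s + lam * N (\<xi> - \<xi>')"
proof -
  have "(transpose C *v \<gamma> - a) \<bullet> (\<xi>' - \<xi>) \<le> lam * N (\<xi>' - \<xi>)"
    using dn unfolding dual_norm_le_iff[OF N] by blast
  moreover have "N (\<xi>' - \<xi>) = N (\<xi> - \<xi>')" using is_norm_minus[OF N, of "\<xi> - \<xi>'"] by simp
  moreover have "(transpose C *v \<gamma>) \<bullet> z = \<gamma> \<bullet> (C *v z)" for z
    by (simp only: dot_lmul_matrix transpose_matrix_vector)
  moreover have "0 \<le> \<gamma> \<bullet> (g - C *v \<xi>)"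
    using \<gamma> \<xi> unfolding inner_vec_def by (intro sum_nonneg) (auto simp: less_eq_vec_def)
  ultimately show ?thesis
    using s by (simp add: inner_diff_left inner_diff_right matrix_vector_mult_diff_distrib
        del: transpose_matrix_vector)
qed

text \<open>The converse of \<open>dual_feasible_imp_bound\<close>: shift the origin to \<open>\<xi>'\<close>, which makes the right-hand side
\<open>g - C *v \<xi>'\<close> of the constraints nonnegative.\<close>

lemma bound_imp_multiplier:
  fixes C :: "real ^ 'm ^ 'p"
  assumes N: "is_norm N" and lam: "0 \<le> lam" and \<xi>': "C *v \<xi>' \<le> g"
    and bound: "\<And>\<xi>. C *v \<xi> \<le> g \<Longrightarrow> a \<bullet> \<xi> + b \<le> s + lam * N (\<xi> - \<xi>')"
  obtains \<gamma> where "b + a \<bullet> \<xi>' + \<gamma> \<bullet> (g - C *v \<xi>') \<le> s"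
    "dual_norm N (transpose C *v \<gamma> - a) \<le> lam" "0 \<le> \<gamma>"
proof -
  have d: "0 \<le> g - C *v \<xi>'" using \<xi>' by simp
  have le: "a \<bullet> z \<le> (s - b - a \<bullet> \<xi>') + lam * N z" if "C *v z \<le> g - C *v \<xi>'" for z
    using bound[of "\<xi>' + z"] that
    by (simp add: matrix_vector_right_distrib inner_add_right le_diff_eq add.commute)
  show ?thesis
  proof (rule polyhedral_norm_multiplier[OF N lam d le])
    fix \<gamma> assume "0 \<le> \<gamma>" "\<gamma> \<bullet> (g - C *v \<xi>') \<le> s - b - a \<bullet> \<xi>'"
      "dual_norm N (transpose C *v \<gamma> - a) \<le> lam"
    then show ?thesis by (intro that[of \<gamma>]) simp_all
  qed
qed

text \<open>A bound on a maximum is a family of bounds on its pieces, and each piece is certified separately by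
its own multiplier \<open>\<gamma> h i j\<close>. The constraints at pairs \<open>(h, i)\<close> of weight zero do not raise the
optimal value, because the certificate in terms of \<open>s\<close> holds at every index.\<close>

lemma worst_case_expectation_Max_affine:
  fixes N :: "real ^ 'm \<Rightarrow> real" and C :: "real ^ 'm ^ 'p"
  assumes N: "is_norm N" and pos: "0 < H" "0 < I" "0 < J"
    and Xi: "Xi = {\<xi>. C *v \<xi> \<le> g}"
    and xi: "\<And>h i. h \<in> {1..H} \<Longrightarrow> i \<in> {1..I} \<Longrightarrow> xi h i \<in> Xi"
    and t: "\<And>h. h \<in> {1..H} \<Longrightarrow> 0 \<le> t h" "(\<Sum>h=1..H. t h) = 1"
    and \<epsilon>: "0 \<le> \<epsilon>"
  shows "worst_case_expectation N Xi \<epsilon> (weighted_empirical Xi H I t xi)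
      (\<lambda>\<xi>. MAX j\<in>{1..J}. a j \<bullet> \<xi> + b j) =
    (INF (lam, s, \<gamma>)\<in>dual_feasible N C g H I J xi a b. ereal (dual_objective \<epsilon> H I t lam s))"
proof -
  \<comment> \<open>Out-of-range pairs are sent to some point of \<open>Xi\<close>, since \<open>y\<close> has to map into \<open>Xi\<close>.\<close>
  define y where "y k = (if k \<in> {1..H} \<times> {1..I} then xi (fst k) (snd k) else xi 1 1)" for k
  define f where "f \<xi> = (MAX j\<in>{1..J}. a j \<bullet> \<xi> + b j)" for \<xi>
  have y: "y k \<in> Xi" for k using xi pos by (auto simp: y_def)
  have yxi: "y (h, i) = xi h i" if "h \<in> {1..H}" "i \<in> {1..I}" for h i using that by (simp add: y_def)
  obtain q where q: "set_pmf q \<subseteq> {1..H} \<times> {1..I}"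
      "weighted_empirical Xi H I t xi = distr q (borel_on Xi) y"
      "\<And>s :: nat \<times> nat \<Rightarrow> real. (\<integral>k. s k \<partial>q) = (\<Sum>h=1..H. \<Sum>i=1..I. t h / real I * s (h, i))"
    using weighted_empirical_eq_distr_pmf[where y = y and xi = xi, OF pos(2) t y yxi] by blast
  have fin: "finite (set_pmf q)" using finite_subset[OF q(1)] by simp
  have J: "finite {1..J}" "{1..J} \<noteq> {}" using pos by auto
  obtain L where L: "0 \<le> L" "\<And>\<xi> \<xi>'. f \<xi> \<le> f \<xi>' + L * N (\<xi> - \<xi>')"
    using Max_affine_lipschitz[OF N J, of a b] unfolding f_def by blast
  have fm: "f \<in> borel_measurable borel"
    unfolding f_def by (intro borel_measurable_Max) auto
  have f_le_iff: "f \<xi> \<le> c \<longleftrightarrow> (\<forall>j\<in>{1..J}. a j \<bullet> \<xi> + b j \<le> c)" for \<xi> c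
    using J unfolding f_def by (subst Max_le_iff) auto
  let ?D = "{(lam, s). 0 \<le> lam \<and> (\<forall>k. \<forall>\<xi>\<in>Xi. f \<xi> \<le> s k + lam * N (\<xi> - y k))}"
  let ?F = "dual_feasible N C g H I J xi a b"
  have "worst_case_expectation N Xi \<epsilon> (weighted_empirical Xi H I t xi) f =
      (INF (lam, s)\<in>?D. ereal (lam * \<epsilon> + (\<integral>k. s k \<partial>q)))"
    unfolding q(2) by (rule worst_case_expectation_dual[OF N fin y \<epsilon> fm L])
  also have "\<dots> = (INF (lam, s, \<gamma>)\<in>?F. ereal (dual_objective \<epsilon> H I t lam s))"
  proof (rule antisym; rule INF_greatest)
    fix F assume F: "F \<in> ?F"
    obtain lam s \<gamma> where Feq: "F = (lam, s, \<gamma>)" by (metis prod_cases3)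
    have feas: "b j + a j \<bullet> xi h i + \<gamma> h i j \<bullet> (g - C *v xi h i) \<le> s h i"
        "dual_norm N (transpose C *v \<gamma> h i j - a j) \<le> lam" "0 \<le> \<gamma> h i j"
      if "h \<in> {1..H}" "i \<in> {1..I}" "j \<in> {1..J}" for h i j
      using F that by (auto simp: Feq dual_feasible_def)
    define s' where "s' k = (if k \<in> {1..H} \<times> {1..I} then s (fst k) (snd k) else s 1 1)" for k
    have bound: "f \<xi> \<le> s h i + lam * N (\<xi> - xi h i)"
      if "\<xi> \<in> Xi" "h \<in> {1..H}" "i \<in> {1..I}" for \<xi> h i
      unfolding f_le_iff
    proof
      fix j assume j: "j \<in> {1..J}"
      show "a j \<bullet> \<xi> + b j \<le> s h i + lam * N (\<xi> - xi h i)"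
        using dual_feasible_imp_bound[OF N _ feas(3)[OF that(2,3) j] feas(2)[OF that(2,3) j]
            feas(1)[OF that(2,3) j]] that(1) Xi by blast
    qed
    have "0 \<le> lam" using feas(2)[of 1 1 1] pos unfolding dual_norm_le_iff[OF N] by simp
    moreover have "f \<xi> \<le> s' k + lam * N (\<xi> - y k)" if "\<xi> \<in> Xi" for k \<xi>
      using bound[OF that, of "fst k" "snd k"] bound[OF that, of 1 1] pos
      by (auto simp: s'_def y_def)
    ultimately have "(lam, s') \<in> ?D" by simp
    moreover have "lam * \<epsilon> + (\<integral>k. s' k \<partial>q) = dual_objective \<epsilon> H I t lam s"
      by (simp add: q(3) dual_objective_def s'_def)
    ultimately show "(INF (lam, s)\<in>?D. ereal (lam * \<epsilon> + (\<integral>k. s k \<partial>q)))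
        \<le> (case F of (lam, s, \<gamma>) \<Rightarrow> ereal (dual_objective \<epsilon> H I t lam s))"
      by (intro INF_lower2[of "(lam, s')"]) (simp_all add: Feq)
  next
    fix G assume G: "G \<in> ?D"
    obtain lam s where Geq: "G = (lam, s)" by fastforce
    have lam: "0 \<le> lam" and bound: "\<And>k \<xi>. \<xi> \<in> Xi \<Longrightarrow> f \<xi> \<le> s k + lam * N (\<xi> - y k)"
      using G by (auto simp: Geq)
    define feas where "feas h i j \<gamma> \<longleftrightarrow> b j + a j \<bullet> xi h i + \<gamma> \<bullet> (g - C *v xi h i) \<le> s (h, i) \<and>
        dual_norm N (transpose C *v \<gamma> - a j) \<le> lam \<and> 0 \<le> \<gamma>" for h i j \<gamma>
    define \<gamma> where "\<gamma> h i j = (SOME c. feas h i j c)" for h i j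
    have "feas h i j (\<gamma> h i j)"
      if h: "h \<in> {1..H}" "i \<in> {1..I}" and j: "j \<in> {1..J}" for h i j
    proof -
      have "C *v xi h i \<le> g" using xi[OF h] Xi by simp
      moreover have "a j \<bullet> \<xi> + b j \<le> s (h, i) + lam * N (\<xi> - xi h i)" if "C *v \<xi> \<le> g" for \<xi>
        using bound[of \<xi> "(h, i)"] that j unfolding Xi f_le_iff yxi[OF h] by simp
      ultimately have "\<exists>c. feas h i j c"
        using bound_imp_multiplier[OF N lam, of C "xi h i" g "a j" "b j" "s (h, i)"]
        unfolding feas_def by blast
      then show ?thesis unfolding \<gamma>_def by (rule someI_ex)
    qed
    then have "(lam, (\<lambda>h i. s (h, i)), \<gamma>) \<in> ?F" by (simp add: dual_feasible_def feas_def)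
    then show "(INF (lam, s, \<gamma>)\<in>?F. ereal (dual_objective \<epsilon> H I t lam s))
        \<le> (case G of (lam, s) \<Rightarrow> ereal (lam * \<epsilon> + (\<integral>k. s k \<partial>q)))"
      by (intro INF_lower2[of "(lam, (\<lambda>h i. s (h, i)), \<gamma>)"])
         (simp_all add: Geq q(3) dual_objective_def)
  qed
  finally show ?thesis unfolding f_def[abs_def] .
qed

theorem theorem2:
  fixes N :: "real ^ 'm \<Rightarrow> real"
    and X :: "(real ^ 'k) set"
    and C :: "real ^ 'm ^ 'p" and g :: "real ^ 'p"
    and Xi :: "(real ^ 'm) set"
    and H I J :: nat
    and l :: "real ^ 'k \<Rightarrow> real ^ 'm \<Rightarrow> real"
    and a :: "nat \<Rightarrow> real ^ 'k \<Rightarrow> real ^ 'm"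
    and b :: "nat \<Rightarrow> real ^ 'k \<Rightarrow> real"
    and xi :: "nat \<Rightarrow> nat \<Rightarrow> real ^ 'm"
    and t :: "nat \<Rightarrow> real"
    and \<epsilon> :: real
  assumes "is_norm N"
    and "0 < H" and "0 < I" and "0 < J"
    and "closed X"
    and "Xi = {\<xi>. C *v \<xi> \<le> g}"
    and "\<And>j. j \<in> {1..J} \<Longrightarrow> linear (a j)"
    and "\<And>j. j \<in> {1..J} \<Longrightarrow> linear (b j)"
    and "\<And>x \<xi>. x \<in> X \<Longrightarrow> \<xi> \<in> Xi \<Longrightarrow> l x \<xi> = (MAX j\<in>{1..J}. a j x \<bullet> \<xi> + b j x)"
    and "\<And>h i. h \<in> {1..H} \<Longrightarrow> i \<in> {1..I} \<Longrightarrow> xi h i \<in> Xi"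
    and "\<And>h. h \<in> {1..H} \<Longrightarrow> t h \<in> {0..1}"
    and "(\<Sum>h=1..H. t h) = 1"
    and "0 \<le> \<epsilon>"
  shows "(\<forall>x\<in>X.
            worst_case_expectation N Xi \<epsilon> (weighted_empirical Xi H I t xi) (l x) =
            (INF (lam, s, \<gamma>)\<in>dual_feasible N C g H I J xi (\<lambda>j. a j x) (\<lambda>j. b j x).
               ereal (dual_objective \<epsilon> H I t lam s)))
       \<and> (INF x\<in>X. worst_case_expectation N Xi \<epsilon> (weighted_empirical Xi H I t xi) (l x)) =
         (INF (x, lam, s, \<gamma>)\<in>{(x, lam, s, \<gamma>). x \<in> X \<and>
                (lam, s, \<gamma>) \<in> dual_feasible N C g H I J xi (\<lambda>j. a j x) (\<lambda>j. b j x)}.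
            ereal (dual_objective \<epsilon> H I t lam s))"
proof -
  have inner: "worst_case_expectation N Xi \<epsilon> (weighted_empirical Xi H I t xi) (l x) =
      (INF (lam, s, \<gamma>)\<in>dual_feasible N C g H I J xi (\<lambda>j. a j x) (\<lambda>j. b j x).
        ereal (dual_objective \<epsilon> H I t lam s))" if x: "x \<in> X" for x
  proof -
    have "worst_case_expectation N Xi \<epsilon> (weighted_empirical Xi H I t xi) (l x) =
        worst_case_expectation N Xi \<epsilon> (weighted_empirical Xi H I t xi)
          (\<lambda>\<xi>. MAX j\<in>{1..J}. a j x \<bullet> \<xi> + b j x)"
      using assms(9)[OF x] by (rule worst_case_expectation_cong)
    also have "\<dots> = (INF (lam, s, \<gamma>)\<in>dual_feasible N C g H I J xi (\<lambda>j. a j x) (\<lambda>j. b j x).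
        ereal (dual_objective \<epsilon> H I t lam s))"
      using assms(11) by (intro worst_case_expectation_Max_affine assms(1-4,6,10,12,13)) auto
    finally show ?thesis .
  qed
  have "(INF x\<in>X. worst_case_expectation N Xi \<epsilon> (weighted_empirical Xi H I t xi) (l x)) =
      (INF x\<in>X. INF (lam, s, \<gamma>)\<in>dual_feasible N C g H I J xi (\<lambda>j. a j x) (\<lambda>j. b j x).
        ereal (dual_objective \<epsilon> H I t lam s))"
    by (intro INF_cong refl inner)
  also have "\<dots> = (INF (x, lam, s, \<gamma>)\<in>{(x, lam, s, \<gamma>). x \<in> X \<and>
        (lam, s, \<gamma>) \<in> dual_feasible N C g H I J xi (\<lambda>j. a j x) (\<lambda>j. b j x)}.
      ereal (dual_objective \<epsilon> H I t lam s))" (is "(INF x\<in>X. ?inner x) = ?joint")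
  proof (rule antisym)
    show "(INF x\<in>X. ?inner x) \<le> ?joint"
    proof (rule INF_greatest, clarify)
      fix x lam s \<gamma>
      assume "x \<in> X" and "(lam, s, \<gamma>) \<in> dual_feasible N C g H I J xi (\<lambda>j. a j x) (\<lambda>j. b j x)"
      then have "?inner x \<le> ereal (dual_objective \<epsilon> H I t lam s)"
        by (intro INF_lower2[of "(lam, s, \<gamma>)"]) auto
      with \<open>x \<in> X\<close> show "(INF x\<in>X. ?inner x) \<le> ereal (dual_objective \<epsilon> H I t lam s)"
        by (rule INF_lower2)
    qed
    show "?joint \<le> (INF x\<in>X. ?inner x)"
    proof (intro INF_greatest, clarify)
      fix x lam s \<gamma>
      assume "x \<in> X" and "(lam, s, \<gamma>) \<in> dual_feasible N C g H I J xi (\<lambda>j. a j x) (\<lambda>j. b j x)"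
      then show "?joint \<le> ereal (dual_objective \<epsilon> H I t lam s)"
        by (intro INF_lower2[of "(x, lam, s, \<gamma>)"]) auto
    qed
  qed
  finally show ?thesis using inner by blast
qed

end
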